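(* Let $(S,* )$ be a multisemigroup and $\Gamma=\Gamma_S$ its action digraph. (a) The multisemigroup $(S,* )$ is nilpotent if and only if there is $m\in\mathbb{N}$ such that the length of any directed path in $\Gamma$ is smaller than $m$. (b) If $(S,* )$ is nilpotent, then the nilpotency degree of $S$ is exactly the length of the longest directed path in $\Gamma$ plus two.
   Context: A multisemigroup is a pair $(S,* )$ with $S$ a non-empty set and $*:S\times S\to 2^S$ a map such that $(a*b)*c=a*(b*c)$ for all $a,b,c\in S$, where for $A,B\subset S$ one puts $A*B:=\bigcup_{a\in A,b\in B}a*b$ and an element is identified with the corresponding singleton. $S^k$ denotes the union of all products $x_1*x_2*\dots*x_k$ with $x_i\in S$. $S$ is nilpotent if $S^k=\varnothing$ for some $k$; the minimal such $k$ is the nilpotency degree of $S$. The action digraph $\Gamma_S$ has vertex set $S$, and for $s,t\in S$ (not necessarily different) there is an oriented edge $s\to t$ if and only if there exists $a\in S$ with $t\in a*s$. A directed path of length $m$ is a sequence $s_0\to s_1\to\dots\to s_m$ of consecutive oriented edges (vertices not necessarily distinct), so its length is the number of edges (a single vertex is a path of length $0$). *)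

theory Defs
  imports "Graph_Theory.Graph_Theory"
begin

definition set_mult :: "('a \<Rightarrow> 'a \<Rightarrow> 'a set) \<Rightarrow> 'a set \<Rightarrow> 'a set \<Rightarrow> 'a set" where
  "set_mult mul A B = (\<Union>a\<in>A. \<Union>b\<in>B. mul a b)"

locale multisemigroup =
  fixes S :: "'a set" and mul :: "'a \<Rightarrow> 'a \<Rightarrow> 'a set"
  assumes nonempty: "S \<noteq> {}"
    and closed: "\<lbrakk>a \<in> S; b \<in> S\<rbrakk> \<Longrightarrow> mul a b \<subseteq> S"
    and assoc: "\<lbrakk>a \<in> S; b \<in> S; c \<in> S\<rbrakk> \<Longrightarrow>
      set_mult mul (mul a b) {c} = set_mult mul {a} (mul b c)"

(* The product of a nonempty list, bracketed to the right; the empty product is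
   left unspecified, as a multisemigroup need not have a unit. *)
fun list_mult :: "('a \<Rightarrow> 'a \<Rightarrow> 'a set) \<Rightarrow> 'a list \<Rightarrow> 'a set" where
  "list_mult mul [x] = {x}"
| "list_mult mul (x # y # ys) = set_mult mul {x} (list_mult mul (y # ys))"

(* S^k; meaningful only for k \<ge> 1. *)
definition ms_power :: "'a set \<Rightarrow> ('a \<Rightarrow> 'a \<Rightarrow> 'a set) \<Rightarrow> nat \<Rightarrow> 'a set" where
  "ms_power S mul k = (\<Union>xs \<in> {xs. length xs = k \<and> set xs \<subseteq> S}. list_mult mul xs)"

definition ms_nilpotent :: "'a set \<Rightarrow> ('a \<Rightarrow> 'a \<Rightarrow> 'a set) \<Rightarrow> bool" where
  "ms_nilpotent S mul \<longleftrightarrow> (\<exists>k\<ge>1. ms_power S mul k = {})"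

definition nilpotency_degree :: "'a set \<Rightarrow> ('a \<Rightarrow> 'a \<Rightarrow> 'a set) \<Rightarrow> nat" where
  "nilpotency_degree S mul = (LEAST k. k \<ge> 1 \<and> ms_power S mul k = {})"

definition action_digraph ::
    "'a set \<Rightarrow> ('a \<Rightarrow> 'a \<Rightarrow> 'a set) \<Rightarrow> ('a, 'a \<times> 'a) pre_digraph" where
  "action_digraph S mul =
     \<lparr> verts = S,
       arcs = {(s, t). s \<in> S \<and> t \<in> S \<and> (\<exists>a\<in>S. t \<in> mul a s)},
       tail = fst, head = snd \<rparr>"

end

theory Submission
  imports Defs
begin

text \<open>
  A product of \<open>n + 1\<close> elements, bracketed to the right, is evaluated by starting with its last factor
  \<open>s\<^sub>0\<close> and multiplying on the left, one factor at a time. Choosing an element \<open>s\<^sub>i\<close> of each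
  intermediate product gives a directed path \<open>s\<^sub>0 \<rightarrow> s\<^sub>1 \<rightarrow> \<dots> \<rightarrow> s\<^sub>n\<close> in the action digraph, and
  conversely each edge of a path supplies a left factor. Hence \<open>S\<^bsup>n+1\<^esup>\<close> is exactly the set of
  endpoints of paths of length \<open>n\<close> (\<open>mem_ms_power_iff_vwalk\<close>).

  So \<open>S\<^bsup>n+1\<^esup>\<close> is empty iff there is no path of length \<open>n\<close>. Emptiness passes to higher powers, so
  nilpotency says that path lengths are bounded. The degree is then the first \<open>k\<close> for which there is
  no path of length \<open>k - 1\<close>: the longest path has length \<open>k - 2\<close>. A longest path exists
  because \<open>S\<close> is non-empty, so that there are paths of length \<open>0\<close>; this is also why \<open>k \<ge> 2\<close>.
\<close>

lemma ms_power_1: "ms_power S mul (Suc 0) = S"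
proof -
  have "{xs. length xs = Suc 0 \<and> set xs \<subseteq> S} = (\<lambda>x. [x]) ` S"
    by (auto simp: length_Suc_conv)
  then show ?thesis
    by (simp add: ms_power_def)
qed

lemma ms_power_Suc_Suc:
  "ms_power S mul (Suc (Suc n)) = set_mult mul S (ms_power S mul (Suc n))"
proof -
  have "{xs. length xs = Suc (Suc n) \<and> set xs \<subseteq> S}
      = (\<Union>a\<in>S. (#) a ` {xs. length xs = Suc n \<and> set xs \<subseteq> S})"
    by (force simp: length_Suc_conv)
  moreover have "list_mult mul (a # xs) = set_mult mul {a} (list_mult mul xs)"
    if "length xs = Suc n" for a xs
    using that by (cases xs) auto
  ultimately show ?thesis
    by (auto simp: ms_power_def set_mult_def)
qed

lemma ms_power_empty_mono:
  assumes "ms_power S mul (Suc m) = {}" and "m \<le> n"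
  shows "ms_power S mul (Suc n) = {}"
  using assms(2,1)
  by (induction n rule: dec_induct) (simp_all add: ms_power_Suc_Suc set_mult_def)

lemma vwalk_action_digraph_snoc:
  assumes "p \<noteq> []"
  shows "vwalk (p @ [t]) (action_digraph S mul) \<longleftrightarrow>
    vwalk p (action_digraph S mul) \<and> t \<in> S \<and> (\<exists>a\<in>S. t \<in> mul a (last p))"
  using assms last_in_set[OF assms]
  by (auto simp: vwalk_def set_vwalk_arcs_snoc action_digraph_def arcs_ends_def arc_to_ends_def)

text \<open>
  An edge out of the endpoint \<open>s\<close> of a path leads to the elements of the products \<open>a * s\<close>, so
  extending a path at its end is multiplying on the left. Closure of \<open>S\<close> under the product keeps
  the new endpoint a vertex of the digraph.
\<close>

lemma (in multisemigroup) mem_ms_power_iff_vwalk: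
  "t \<in> ms_power S mul (Suc n) \<longleftrightarrow>
    (\<exists>p. vwalk p (action_digraph S mul) \<and> vwalk_length p = n \<and> last p = t)"
proof (induction n arbitrary: t)
  case 0
  have "vwalk p (action_digraph S mul) \<and> vwalk_length p = 0 \<and> last p = t \<longleftrightarrow> p = [t] \<and> t \<in> S" for p
    by (cases p) (auto simp: vwalk_def action_digraph_def)
  then show ?case
    by (simp add: ms_power_1)
next
  case (Suc n)
  show ?case
  proof
    assume "t \<in> ms_power S mul (Suc (Suc n))"
    then obtain a s where a: "a \<in> S" "t \<in> mul a s" and s: "s \<in> ms_power S mul (Suc n)"
      by (auto simp: ms_power_Suc_Suc set_mult_def)
    from s obtain p where p: "vwalk p (action_digraph S mul)" "vwalk_length p = n" "last p = s"
      by (auto simp: Suc.IH)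
    then have "p \<noteq> []" and "set p \<subseteq> S"
      by (auto simp: vwalk_def action_digraph_def)
    with p have "s \<in> S"
      using last_in_set by blast
    with a have "t \<in> S"
      using closed by blast
    with a p \<open>p \<noteq> []\<close> have "vwalk (p @ [t]) (action_digraph S mul)"
      by (auto simp: vwalk_action_digraph_snoc)
    moreover have "vwalk_length (p @ [t]) = Suc n"
      using p \<open>p \<noteq> []\<close> by (cases p) auto
    ultimately show "\<exists>p. vwalk p (action_digraph S mul) \<and> vwalk_length p = Suc n \<and> last p = t"
      by (metis last_snoc)
  next
    assume "\<exists>p. vwalk p (action_digraph S mul) \<and> vwalk_length p = Suc n \<and> last p = t"
    then obtain p where p: "vwalk p (action_digraph S mul)" "vwalk_length p = Suc n" "last p = t"
      by blast
    then have "p \<noteq> []"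
      by (auto simp: vwalk_def)
    with p obtain q where q: "p = q @ [t]"
      by (metis append_butlast_last_id)
    with p have "q \<noteq> []" and "vwalk_length q = n"
      by (cases q; auto)+
    from p q \<open>q \<noteq> []\<close> obtain a where
      "vwalk q (action_digraph S mul)" and a: "a \<in> S" "t \<in> mul a (last q)"
      by (auto simp: vwalk_action_digraph_snoc)
    then have "last q \<in> ms_power S mul (Suc n)"
      unfolding Suc.IH using \<open>vwalk_length q = n\<close> by blast
    with a show "t \<in> ms_power S mul (Suc (Suc n))"
      by (auto simp: ms_power_Suc_Suc set_mult_def)
  qed
qed

text \<open>
  The absence of paths of the single length \<open>m\<close> already bounds all lengths, because an empty power
  makes all higher powers empty.
\<close>

lemma (in multisemigroup) ms_power_empty_iff_vwalk_bounded:
  "ms_power S mul (Suc m) = {} \<longleftrightarrow>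
    (\<forall>p. vwalk p (action_digraph S mul) \<longrightarrow> vwalk_length p < m)"
proof
  assume empty: "ms_power S mul (Suc m) = {}"
  show "\<forall>p. vwalk p (action_digraph S mul) \<longrightarrow> vwalk_length p < m"
  proof (intro allI impI)
    fix p assume "vwalk p (action_digraph S mul)"
    then have "ms_power S mul (Suc (vwalk_length p)) \<noteq> {}"
      using mem_ms_power_iff_vwalk by blast
    then show "vwalk_length p < m"
      using ms_power_empty_mono[OF empty] not_less by blast
  qed
next
  assume "\<forall>p. vwalk p (action_digraph S mul) \<longrightarrow> vwalk_length p < m"
  then have "t \<notin> ms_power S mul (Suc m)" for t
    unfolding mem_ms_power_iff_vwalk by blast
  then show "ms_power S mul (Suc m) = {}"
    by blast
qed

theorem proposition25:
  fixes S :: "'a set" and mul :: "'a \<Rightarrow> 'a \<Rightarrow> 'a set"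
  assumes "multisemigroup S mul"
  shows "(ms_nilpotent S mul \<longleftrightarrow>
            (\<exists>m::nat. \<forall>p. vwalk p (action_digraph S mul) \<longrightarrow> vwalk_length p < m))
       \<and> (ms_nilpotent S mul \<longrightarrow>
            (\<exists>p. vwalk p (action_digraph S mul)
               \<and> (\<forall>q. vwalk q (action_digraph S mul) \<longrightarrow> vwalk_length q \<le> vwalk_length p)
               \<and> nilpotency_degree S mul = vwalk_length p + 2))"
proof (intro conjI impI)
  interpret multisemigroup S mul by fact
  let ?G = "action_digraph S mul"
  have "ms_nilpotent S mul \<longleftrightarrow> (\<exists>m. ms_power S mul (Suc m) = {})"
    unfolding ms_nilpotent_def by (metis Suc_le_D Suc_le_mono le0 One_nat_def)
  then show bounded_iff:
    "ms_nilpotent S mul \<longleftrightarrow> (\<exists>m. \<forall>p. vwalk p ?G \<longrightarrow> vwalk_length p < m)"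
    by (simp add: ms_power_empty_iff_vwalk_bounded)
  assume "ms_nilpotent S mul"
  with bounded_iff obtain m where m: "\<forall>p. vwalk p ?G \<longrightarrow> vwalk_length p < m"
    by blast
  obtain s where "s \<in> S"
    using nonempty by blast
  then have "vwalk [s] ?G"
    by (simp add: vwalk_def action_digraph_def)
  then obtain p where p: "vwalk p ?G" "\<forall>q. vwalk q ?G \<longrightarrow> vwalk_length q \<le> vwalk_length p"
    using ex_has_greatest_nat[of "\<lambda>p. vwalk p ?G" "[s]" vwalk_length m] m by (metis less_imp_le)
  have "nilpotency_degree S mul = vwalk_length p + 2"
    unfolding nilpotency_degree_def
  proof (rule Least_equality)
    have "ms_power S mul (Suc (Suc (vwalk_length p))) = {}"
      unfolding ms_power_empty_iff_vwalk_bounded using p by (auto simp: less_Suc_eq_le)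
    then show "1 \<le> vwalk_length p + 2 \<and> ms_power S mul (vwalk_length p + 2) = {}"
      by simp
  next
    fix k assume k: "1 \<le> k \<and> ms_power S mul k = {}"
    then obtain j where j: "k = Suc j"
      by (cases k) auto
    with k p(1) have "vwalk_length p < j"
      by (auto simp: ms_power_empty_iff_vwalk_bounded)
    with j show "vwalk_length p + 2 \<le> k"
      by simp
  qed
  with p show "\<exists>p. vwalk p ?G \<and> (\<forall>q. vwalk q ?G \<longrightarrow> vwalk_length q \<le> vwalk_length p)
      \<and> nilpotency_degree S mul = vwalk_length p + 2"
    by blast
qed

end
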